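(* Let $(\Omega,\Sigma_\Omega)$ be a standard Borel space with a probability measure $\mu$, and let $\ell:\Omega\to[0,\infty)$ be measurable. Let $(k_i)_{i\in\mathbb{N}}$, $\mathbb{N}=\{1,2,\dots\}$, be a countable family of Markov kernels $k_i:\Omega\times\Sigma_\Omega\to[0,1]$, each Green with respect to $\ell$ and $\mu$ with ratio $r_i:\Omega\times\Omega\to[0,\infty]$. Let $c:\Omega\times\mathbb{N}\to[0,1]$ be a (measurable) parameterized probability distribution function over $\mathbb{N}$, i.e. $\sum_{i=1}^\infty c(\omega,i)=1$ for all $\omega\in\Omega$. Suppose that one can always detect which kernel was used, i.e. there is a (measurable) function $e:\Omega\times\Omega\to\mathbb{N}$ such that for every $i$, the law of $(\omega,\omega',e(\omega,\omega'))$ equals the law of $(\omega,\omega',i)$ when $\omega\sim\mu$ and $\omega'\sim k_i(\omega,-)$. Then the mixed kernel $$k(\omega,U)=\sum_{i=1}^\infty c(\omega,i)\cdot k_i(\omega,U)$$ is a Green kernel with respect to $\ell$ and $\mu$, with ratio $r:\Omega\times\Omega\to[0,\infty]$ given by $$r(\omega,\omega')=r_i(\omega,\omega')\cdot\frac{c(\omega',i)}{c(\omega,i)}\qquad\text{where } i=e(\omega,\omega').$$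
   Context: A Markov kernel $k:\Omega\times\Sigma_\Omega\to[0,1]$ is a function such that each $k(\omega,-)$ is a probability measure and each $k(-,U)$ is measurable. Given $\mu$, $\ell$ and $k$, define measures on $\Omega\times\Omega$ by $$m(U)=\int_\Omega\int_\Omega[(\omega_1,\omega_2)\in U]\,\ell(\omega_1)\,k(\omega_1,\mathrm{d}\omega_2)\,\mu(\mathrm{d}\omega_1),\qquad m_{\mathit{rev}}(U)=\int_\Omega\int_\Omega[(\omega_2,\omega_1)\in U]\,\ell(\omega_1)\,k(\omega_1,\mathrm{d}\omega_2)\,\mu(\mathrm{d}\omega_1).$$ $k$ is Green with respect to $\ell$ and $\mu$ if $m_{\mathit{rev}}$ is absolutely continuous with respect to $m$; a ratio for $k$ is a Radon–Nikodym derivative, i.e. a measurable $r$ with $m_{\mathit{rev}}(U)=\int_\Omega\int_\Omega[(\omega_1,\omega_2)\in U]\,r(\omega_1,\omega_2)\,\ell(\omega_1)\,k(\omega_1,\mathrm{d}\omega_2)\,\mu(\mathrm{d}\omega_1)$ for all measurable $U\subseteq\Omega\times\Omega$.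
   Formalization: It is additionally assumed that for each i, for almost all (ω,ω') under ℓ(ω)k_i(ω,dω')μ(dω), c(ω,i)>0 implies c(ω',i)>0; without this the mixed kernel need not be Green. *)

theory Defs
  imports "HOL-Probability.Probability"
begin

definition standard_borel :: "'a measure \<Rightarrow> bool" where
  "standard_borel M \<longleftrightarrow>
     (\<exists>X. topspace X = space M \<and> completely_metrizable_space X \<and> separable_space X \<and>
          sets M = sigma_sets (topspace X) {U. openin X U})"

text \<open>
  In the following, \<open>\<mu>\<close> carries the measurable space, and a Markov kernel on it is an
  element of \<open>\<mu> \<rightarrow>\<^sub>M prob_algebra \<mu>\<close>.
\<close>

definition joint_meas :: "'a measure \<Rightarrow> ('a \<Rightarrow> real) \<Rightarrow> ('a \<Rightarrow> 'a measure) \<Rightarrow> ('a \<times> 'a) measure" where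
  "joint_meas \<mu> l k = measure_of (space (\<mu> \<Otimes>\<^sub>M \<mu>)) (sets (\<mu> \<Otimes>\<^sub>M \<mu>))
     (\<lambda>U. \<integral>\<^sup>+ \<omega>1. (\<integral>\<^sup>+ \<omega>2. indicator U (\<omega>1, \<omega>2) * ennreal (l \<omega>1) \<partial>k \<omega>1) \<partial>\<mu>)"

definition joint_meas_rev :: "'a measure \<Rightarrow> ('a \<Rightarrow> real) \<Rightarrow> ('a \<Rightarrow> 'a measure) \<Rightarrow> ('a \<times> 'a) measure" where
  "joint_meas_rev \<mu> l k = measure_of (space (\<mu> \<Otimes>\<^sub>M \<mu>)) (sets (\<mu> \<Otimes>\<^sub>M \<mu>))
     (\<lambda>U. \<integral>\<^sup>+ \<omega>1. (\<integral>\<^sup>+ \<omega>2. indicator U (\<omega>2, \<omega>1) * ennreal (l \<omega>1) \<partial>k \<omega>1) \<partial>\<mu>)"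

definition green_kernel :: "'a measure \<Rightarrow> ('a \<Rightarrow> real) \<Rightarrow> ('a \<Rightarrow> 'a measure) \<Rightarrow> bool" where
  "green_kernel \<mu> l k \<longleftrightarrow>
     k \<in> \<mu> \<rightarrow>\<^sub>M prob_algebra \<mu> \<and>
     absolutely_continuous (joint_meas \<mu> l k) (joint_meas_rev \<mu> l k)"

definition is_ratio ::
  "'a measure \<Rightarrow> ('a \<Rightarrow> real) \<Rightarrow> ('a \<Rightarrow> 'a measure) \<Rightarrow> ('a \<Rightarrow> 'a \<Rightarrow> ennreal) \<Rightarrow> bool" where
  "is_ratio \<mu> l k r \<longleftrightarrow>
     (\<lambda>(\<omega>1, \<omega>2). r \<omega>1 \<omega>2) \<in> borel_measurable (\<mu> \<Otimes>\<^sub>M \<mu>) \<and>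
     (\<forall>U\<in>sets (\<mu> \<Otimes>\<^sub>M \<mu>). emeasure (joint_meas_rev \<mu> l k) U =
        (\<integral>\<^sup>+ \<omega>1. (\<integral>\<^sup>+ \<omega>2. indicator U (\<omega>1, \<omega>2) * r \<omega>1 \<omega>2 * ennreal (l \<omega>1) \<partial>k \<omega>1) \<partial>\<mu>))"

text \<open>
  The index set is \<open>{1..}\<close>, hence the summation over \<open>Suc i\<close>.
\<close>

definition mixed_kernel ::
  "'a measure \<Rightarrow> ('a \<Rightarrow> nat \<Rightarrow> real) \<Rightarrow> (nat \<Rightarrow> 'a \<Rightarrow> 'a measure) \<Rightarrow> 'a \<Rightarrow> 'a measure" where
  "mixed_kernel \<mu> c k \<omega> = measure_of (space \<mu>) (sets \<mu>)
     (\<lambda>U. \<Sum>i. ennreal (c \<omega> (Suc i)) * emeasure (k (Suc i) \<omega>) U)"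

text \<open>
  The set functions handed to \<^const>\<open>measure_of\<close> above are measures, so that the
  constants have the intended values.
\<close>

lemma sets_joint_meas [simp]: "sets (joint_meas \<mu> l k) = sets (\<mu> \<Otimes>\<^sub>M \<mu>)"
  and sets_joint_meas_rev [simp]: "sets (joint_meas_rev \<mu> l k) = sets (\<mu> \<Otimes>\<^sub>M \<mu>)"
  and sets_mixed_kernel [simp]: "sets (mixed_kernel \<mu> c K \<omega>) = sets \<mu>"
  by (simp_all add: joint_meas_def joint_meas_rev_def mixed_kernel_def)

lemma emeasure_joint_meas:
  assumes k[measurable]: "k \<in> \<mu> \<rightarrow>\<^sub>M prob_algebra \<mu>"
    and l[measurable]: "l \<in> borel_measurable \<mu>"
    and U[measurable]: "U \<in> sets (\<mu> \<Otimes>\<^sub>M \<mu>)"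
  shows "emeasure (joint_meas \<mu> l k) U =
    (\<integral>\<^sup>+ \<omega>1. (\<integral>\<^sup>+ \<omega>2. indicator U (\<omega>1, \<omega>2) * ennreal (l \<omega>1) \<partial>k \<omega>1) \<partial>\<mu>)"
proof (rule emeasure_measure_of[OF joint_meas_def])
  have ks: "k \<in> \<mu> \<rightarrow>\<^sub>M subprob_algebra \<mu>"
    using k by (rule measurable_prob_algebraD)
  show "countably_additive (sets (joint_meas \<mu> l k))
     (\<lambda>U. \<integral>\<^sup>+ \<omega>1. (\<integral>\<^sup>+ \<omega>2. indicator U (\<omega>1, \<omega>2) * ennreal (l \<omega>1) \<partial>k \<omega>1) \<partial>\<mu>)"
  proof (rule countably_additiveI)
    fix A :: "nat \<Rightarrow> ('a \<times> 'a) set"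
    assume A: "range A \<subseteq> sets (joint_meas \<mu> l k)" "disjoint_family A"
    have Am[measurable]: "A i \<in> sets (\<mu> \<Otimes>\<^sub>M \<mu>)" for i
      using A(1) by auto
    have eq: "(\<integral>\<^sup>+ y. indicator (\<Union>i. A i) (x, y) * ennreal (l x) \<partial>k x) =
        (\<Sum>i. \<integral>\<^sup>+ y. indicator (A i) (x, y) * ennreal (l x) \<partial>k x)" if x: "x \<in> space \<mu>" for x
    proof -
      have [measurable_cong]: "sets (k x) = sets \<mu>"
        using sets_kernel[OF ks x] .
      note x[measurable]
      have "(\<integral>\<^sup>+ y. indicator (\<Union>i. A i) (x, y) * ennreal (l x) \<partial>k x) =
          (\<integral>\<^sup>+ y. (\<Sum>i. indicator (A i) (x, y) * ennreal (l x)) \<partial>k x)"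
        by (simp add: suminf_indicator[OF A(2), symmetric])
      also have "\<dots> = (\<Sum>i. \<integral>\<^sup>+ y. indicator (A i) (x, y) * ennreal (l x) \<partial>k x)"
        by (intro nn_integral_suminf) measurable
      finally show ?thesis .
    qed
    have "(\<integral>\<^sup>+ x. (\<integral>\<^sup>+ y. indicator (\<Union>i. A i) (x, y) * ennreal (l x) \<partial>k x) \<partial>\<mu>) =
       (\<integral>\<^sup>+ x. (\<Sum>i. \<integral>\<^sup>+ y. indicator (A i) (x, y) * ennreal (l x) \<partial>k x) \<partial>\<mu>)"
      by (intro nn_integral_cong eq)
    also have "\<dots> = (\<Sum>i. \<integral>\<^sup>+ x. (\<integral>\<^sup>+ y. indicator (A i) (x, y) * ennreal (l x) \<partial>k x) \<partial>\<mu>)"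
      by (intro nn_integral_suminf nn_integral_measurable_subprob_algebra2[OF _ ks]) measurable
    finally show "(\<Sum>i. \<integral>\<^sup>+ x. (\<integral>\<^sup>+ y. indicator (A i) (x, y) * ennreal (l x) \<partial>k x) \<partial>\<mu>) =
      (\<integral>\<^sup>+ x. (\<integral>\<^sup>+ y. indicator (\<Union>i. A i) (x, y) * ennreal (l x) \<partial>k x) \<partial>\<mu>)" ..
  qed
qed (use U sets.space_closed in \<open>auto simp: positive_def\<close>)

lemma emeasure_joint_meas_rev:
  assumes k[measurable]: "k \<in> \<mu> \<rightarrow>\<^sub>M prob_algebra \<mu>"
    and l[measurable]: "l \<in> borel_measurable \<mu>"
    and U[measurable]: "U \<in> sets (\<mu> \<Otimes>\<^sub>M \<mu>)"
  shows "emeasure (joint_meas_rev \<mu> l k) U =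
    (\<integral>\<^sup>+ \<omega>1. (\<integral>\<^sup>+ \<omega>2. indicator U (\<omega>2, \<omega>1) * ennreal (l \<omega>1) \<partial>k \<omega>1) \<partial>\<mu>)"
proof (rule emeasure_measure_of[OF joint_meas_rev_def])
  have ks: "k \<in> \<mu> \<rightarrow>\<^sub>M subprob_algebra \<mu>"
    using k by (rule measurable_prob_algebraD)
  show "countably_additive (sets (joint_meas_rev \<mu> l k))
     (\<lambda>U. \<integral>\<^sup>+ \<omega>1. (\<integral>\<^sup>+ \<omega>2. indicator U (\<omega>2, \<omega>1) * ennreal (l \<omega>1) \<partial>k \<omega>1) \<partial>\<mu>)"
  proof (rule countably_additiveI)
    fix A :: "nat \<Rightarrow> ('a \<times> 'a) set"
    assume A: "range A \<subseteq> sets (joint_meas_rev \<mu> l k)" "disjoint_family A"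
    have Am[measurable]: "A i \<in> sets (\<mu> \<Otimes>\<^sub>M \<mu>)" for i
      using A(1) by auto
    have eq: "(\<integral>\<^sup>+ y. indicator (\<Union>i. A i) (y, x) * ennreal (l x) \<partial>k x) =
        (\<Sum>i. \<integral>\<^sup>+ y. indicator (A i) (y, x) * ennreal (l x) \<partial>k x)" if x: "x \<in> space \<mu>" for x
    proof -
      have [measurable_cong]: "sets (k x) = sets \<mu>"
        using sets_kernel[OF ks x] .
      note x[measurable]
      have "(\<integral>\<^sup>+ y. indicator (\<Union>i. A i) (y, x) * ennreal (l x) \<partial>k x) =
          (\<integral>\<^sup>+ y. (\<Sum>i. indicator (A i) (y, x) * ennreal (l x)) \<partial>k x)"
        by (simp add: suminf_indicator[OF A(2), symmetric])
      also have "\<dots> = (\<Sum>i. \<integral>\<^sup>+ y. indicator (A i) (y, x) * ennreal (l x) \<partial>k x)"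
        by (intro nn_integral_suminf) measurable
      finally show ?thesis .
    qed
    have "(\<integral>\<^sup>+ x. (\<integral>\<^sup>+ y. indicator (\<Union>i. A i) (y, x) * ennreal (l x) \<partial>k x) \<partial>\<mu>) =
       (\<integral>\<^sup>+ x. (\<Sum>i. \<integral>\<^sup>+ y. indicator (A i) (y, x) * ennreal (l x) \<partial>k x) \<partial>\<mu>)"
      by (intro nn_integral_cong eq)
    also have "\<dots> = (\<Sum>i. \<integral>\<^sup>+ x. (\<integral>\<^sup>+ y. indicator (A i) (y, x) * ennreal (l x) \<partial>k x) \<partial>\<mu>)"
      by (intro nn_integral_suminf nn_integral_measurable_subprob_algebra2[OF _ ks]) measurable
    finally show "(\<Sum>i. \<integral>\<^sup>+ x. (\<integral>\<^sup>+ y. indicator (A i) (y, x) * ennreal (l x) \<partial>k x) \<partial>\<mu>) =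
      (\<integral>\<^sup>+ x. (\<integral>\<^sup>+ y. indicator (\<Union>i. A i) (y, x) * ennreal (l x) \<partial>k x) \<partial>\<mu>)" ..
  qed
qed (use U sets.space_closed in \<open>auto simp: positive_def\<close>)

lemma emeasure_mixed_kernel:
  assumes k: "\<And>i. i \<ge> 1 \<Longrightarrow> k i \<in> \<mu> \<rightarrow>\<^sub>M prob_algebra \<mu>"
    and \<omega>: "\<omega> \<in> space \<mu>" and U: "U \<in> sets \<mu>"
  shows "emeasure (mixed_kernel \<mu> c k \<omega>) U =
    (\<Sum>i. ennreal (c \<omega> (Suc i)) * emeasure (k (Suc i) \<omega>) U)"
proof (rule emeasure_measure_of[OF mixed_kernel_def])
  have s: "sets (k (Suc i) \<omega>) = sets \<mu>" for i
    using sets_kernel[OF measurable_prob_algebraD[OF k] \<omega>] by simp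
  show "countably_additive (sets (mixed_kernel \<mu> c k \<omega>))
     (\<lambda>U. \<Sum>i. ennreal (c \<omega> (Suc i)) * emeasure (k (Suc i) \<omega>) U)"
  proof (rule countably_additiveI)
    fix A :: "nat \<Rightarrow> 'a set"
    assume A: "range A \<subseteq> sets (mixed_kernel \<mu> c k \<omega>)" "disjoint_family A"
    have "(\<Sum>j. \<Sum>i. ennreal (c \<omega> (Suc i)) * emeasure (k (Suc i) \<omega>) (A j)) =
      (\<Sum>i. \<Sum>j. ennreal (c \<omega> (Suc i)) * emeasure (k (Suc i) \<omega>) (A j))"
      using nn_integral_suminf[of "\<lambda>i j. ennreal (c \<omega> (Suc i)) * emeasure (k (Suc i) \<omega>) (A j)"
          "count_space UNIV"]
      unfolding nn_integral_count_space_nat by simp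
    also have "\<dots> = (\<Sum>i. ennreal (c \<omega> (Suc i)) * emeasure (k (Suc i) \<omega>) (\<Union>j. A j))"
      using A by (simp add: suminf_emeasure s)
    finally show "(\<Sum>j. \<Sum>i. ennreal (c \<omega> (Suc i)) * emeasure (k (Suc i) \<omega>) (A j)) =
      (\<Sum>i. ennreal (c \<omega> (Suc i)) * emeasure (k (Suc i) \<omega>) (\<Union>j. A j))" .
  qed
qed (use U sets.space_closed in \<open>auto simp: positive_def\<close>)

end

theory Submission
  imports Defs
begin

text \<open>
  A ratio for \<open>k\<close> is a density of the swapped joint measure with respect to the joint measure
  \<open>m\<close>. The joint measure of the mixture integrates \<open>f\<close> to \<open>\<Sum>i. \<integral> c(x,i) f(x,y) dm\<^sub>i\<close>, so its
  swap integrates \<open>f\<close> to \<open>\<Sum>i. \<integral> c(y,i) f(x,y) r\<^sub>i(x,y) dm\<^sub>i\<close>. Because \<open>e = i\<close> holds \<open>m\<^sub>i\<close>-almost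
  everywhere, it remains to see that \<open>r\<^sub>i(x,y) c(y,i) = c(x,i) r\<^sub>i(x,y) c(y,i) / c(x,i)\<close> holds
  \<open>m\<^sub>i\<close>-almost everywhere. This could only fail where \<open>c(x,i) = 0\<close>, \<open>c(y,i) > 0\<close> and
  \<open>r\<^sub>i(x,y) > 0\<close>, and that set is null since its swap is excluded by the support condition.
\<close>

section \<open>Integration against the joint measure and its reversal\<close>

text \<open>The definition of \<open>joint_meas\<close> only gives values on sets; as a bind, the
  measure inherits the integration rules of the Giry monad. The weight \<open>l\<close> sits in the
  base measure because it may exceed 1, so that a kernel weighted by \<open>l\<close> could leave
  \<open>subprob_algebra\<close>.\<close>

lemma joint_meas_eq_bind:
  assumes k: "k \<in> \<mu> \<rightarrow>\<^sub>M prob_algebra \<mu>" and l[measurable]: "l \<in> borel_measurable \<mu>"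
    and ne: "space \<mu> \<noteq> {}"
  shows "joint_meas \<mu> l k = density \<mu> l \<bind> (\<lambda>x. distr (k x) (\<mu> \<Otimes>\<^sub>M \<mu>) (Pair x))"
proof -
  note ks[measurable] = measurable_prob_algebraD[OF k]
  have K: "(\<lambda>x. distr (k x) (\<mu> \<Otimes>\<^sub>M \<mu>) (Pair x)) \<in> density \<mu> l \<rightarrow>\<^sub>M subprob_algebra (\<mu> \<Otimes>\<^sub>M \<mu>)"
    by (rule measurable_distr2[where M=\<mu>]) simp_all
  show ?thesis
  proof (rule measure_eqI)
    show "sets (joint_meas \<mu> l k) = sets (density \<mu> l \<bind> (\<lambda>x. distr (k x) (\<mu> \<Otimes>\<^sub>M \<mu>) (Pair x)))"
      by (subst sets_bind[of _ _ "\<mu> \<Otimes>\<^sub>M \<mu>"]) (use ne in auto)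
    fix U assume "U \<in> sets (joint_meas \<mu> l k)"
    then have U[measurable]: "U \<in> sets (\<mu> \<Otimes>\<^sub>M \<mu>)" by simp
    have "emeasure (density \<mu> l \<bind> (\<lambda>x. distr (k x) (\<mu> \<Otimes>\<^sub>M \<mu>) (Pair x))) U =
        (\<integral>\<^sup>+x. l x * emeasure (distr (k x) (\<mu> \<Otimes>\<^sub>M \<mu>) (Pair x)) U \<partial>\<mu>)"
      using ne K measurable_emeasure_kernel[OF K U]
      by (simp add: emeasure_bind[OF _ K U] nn_integral_density)
    also have "\<dots> = emeasure (joint_meas \<mu> l k) U"
      unfolding emeasure_joint_meas[OF k l U]
    proof (rule nn_integral_cong)
      fix x assume x[measurable]: "x \<in> space \<mu>"
      have [measurable_cong, simp]: "sets (k x) = sets \<mu>"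
        using sets_kernel[OF ks x] .
      have [measurable]: "Pair x \<in> k x \<rightarrow>\<^sub>M \<mu> \<Otimes>\<^sub>M \<mu>"
        using measurable_Pair1'[OF x, of \<mu>] by (simp cong: measurable_cong_sets)
      have "emeasure (distr (k x) (\<mu> \<Otimes>\<^sub>M \<mu>) (Pair x)) U = (\<integral>\<^sup>+y. indicator U (x, y) \<partial>k x)"
        by (simp add: nn_integral_distr flip: nn_integral_indicator)
      moreover have "(\<integral>\<^sup>+y. indicator U (x, y) * ennreal (l x) \<partial>k x) =
          (\<integral>\<^sup>+y. indicator U (x, y) \<partial>k x) * ennreal (l x)"
        by (rule nn_integral_multc) measurable
      ultimately show "l x * emeasure (distr (k x) (\<mu> \<Otimes>\<^sub>M \<mu>) (Pair x)) U =
          (\<integral>\<^sup>+y. indicator U (x, y) * ennreal (l x) \<partial>k x)"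
        by (simp only: mult.commute)
    qed
    finally show "emeasure (joint_meas \<mu> l k) U =
        emeasure (density \<mu> l \<bind> (\<lambda>x. distr (k x) (\<mu> \<Otimes>\<^sub>M \<mu>) (Pair x))) U" ..
  qed
qed

text \<open>Extends the defining formula from indicators to nonnegative measurable integrands: the
  bind gives the iterated integral, and the pushforward along \<open>Pair x\<close> substitutes
  \<open>(x, y)\<close> in the inner one.\<close>

lemma nn_integral_joint_meas:
  assumes k: "k \<in> \<mu> \<rightarrow>\<^sub>M prob_algebra \<mu>" and l[measurable]: "l \<in> borel_measurable \<mu>"
    and ne: "space \<mu> \<noteq> {}" and f[measurable]: "f \<in> borel_measurable (\<mu> \<Otimes>\<^sub>M \<mu>)"
  shows "(\<integral>\<^sup>+p. f p \<partial>joint_meas \<mu> l k) = (\<integral>\<^sup>+x. (\<integral>\<^sup>+y. f (x, y) * ennreal (l x) \<partial>k x) \<partial>\<mu>)"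
proof -
  note ks[measurable] = measurable_prob_algebraD[OF k]
  have K: "(\<lambda>x. distr (k x) (\<mu> \<Otimes>\<^sub>M \<mu>) (Pair x)) \<in> density \<mu> l \<rightarrow>\<^sub>M subprob_algebra (\<mu> \<Otimes>\<^sub>M \<mu>)"
    by (rule measurable_distr2[where M=\<mu>]) simp_all
  have "(\<integral>\<^sup>+p. f p \<partial>joint_meas \<mu> l k) =
      (\<integral>\<^sup>+x. l x * (\<integral>\<^sup>+p. f p \<partial>distr (k x) (\<mu> \<Otimes>\<^sub>M \<mu>) (Pair x)) \<partial>\<mu>)"
    using measurable_compose[OF K nn_integral_measurable_subprob_algebra[OF f]]
    by (simp add: joint_meas_eq_bind[OF k l ne] nn_integral_bind[OF f K] nn_integral_density)
  also have "\<dots> = (\<integral>\<^sup>+x. (\<integral>\<^sup>+y. f (x, y) * ennreal (l x) \<partial>k x) \<partial>\<mu>)"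
  proof (rule nn_integral_cong)
    fix x assume x[measurable]: "x \<in> space \<mu>"
    have [measurable_cong, simp]: "sets (k x) = sets \<mu>"
      using sets_kernel[OF ks x] .
    have [measurable]: "Pair x \<in> k x \<rightarrow>\<^sub>M \<mu> \<Otimes>\<^sub>M \<mu>"
      using measurable_Pair1'[OF x, of \<mu>] by (simp cong: measurable_cong_sets)
    have "(\<integral>\<^sup>+y. f (x, y) * ennreal (l x) \<partial>k x) = (\<integral>\<^sup>+y. f (x, y) \<partial>k x) * ennreal (l x)"
      by (rule nn_integral_multc) measurable
    then show "l x * (\<integral>\<^sup>+p. f p \<partial>distr (k x) (\<mu> \<Otimes>\<^sub>M \<mu>) (Pair x)) =
        (\<integral>\<^sup>+y. f (x, y) * ennreal (l x) \<partial>k x)"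
      by (simp add: nn_integral_distr mult.commute[of "ennreal (l x)"])
  qed
  finally show ?thesis .
qed

text \<open>Both sides integrate the indicator of \<open>U\<close> after exchanging the coordinates.
  Statements about the reversed measure thereby reduce to statements about
  \<open>joint_meas\<close>.\<close>

lemma joint_meas_rev_eq_distr:
  assumes k: "k \<in> \<mu> \<rightarrow>\<^sub>M prob_algebra \<mu>" and l: "l \<in> borel_measurable \<mu>"
    and ne: "space \<mu> \<noteq> {}"
  shows "joint_meas_rev \<mu> l k = distr (joint_meas \<mu> l k) (\<mu> \<Otimes>\<^sub>M \<mu>) prod.swap"
proof (rule measure_eqI)
  have [measurable_cong]: "sets (joint_meas \<mu> l k) = sets (\<mu> \<Otimes>\<^sub>M \<mu>)" by simp
  have [measurable]: "prod.swap \<in> \<mu> \<Otimes>\<^sub>M \<mu> \<rightarrow>\<^sub>M \<mu> \<Otimes>\<^sub>M \<mu>"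
    by (simp add: prod.swap_def[abs_def])
  fix U assume "U \<in> sets (joint_meas_rev \<mu> l k)"
  then have U[measurable]: "U \<in> sets (\<mu> \<Otimes>\<^sub>M \<mu>)" by simp
  have "emeasure (distr (joint_meas \<mu> l k) (\<mu> \<Otimes>\<^sub>M \<mu>) prod.swap) U =
      (\<integral>\<^sup>+p. indicator U (prod.swap p) \<partial>joint_meas \<mu> l k)"
    by (simp add: nn_integral_distr flip: nn_integral_indicator)
  then show "emeasure (joint_meas_rev \<mu> l k) U =
      emeasure (distr (joint_meas \<mu> l k) (\<mu> \<Otimes>\<^sub>M \<mu>) prod.swap) U"
    by (simp add: emeasure_joint_meas_rev[OF k l U] nn_integral_joint_meas[OF k l ne])
qed simp

lemma nn_integral_joint_meas_rev:
  assumes k: "k \<in> \<mu> \<rightarrow>\<^sub>M prob_algebra \<mu>" and l: "l \<in> borel_measurable \<mu>"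
    and ne: "space \<mu> \<noteq> {}" and f: "f \<in> borel_measurable (\<mu> \<Otimes>\<^sub>M \<mu>)"
  shows "(\<integral>\<^sup>+p. f p \<partial>joint_meas_rev \<mu> l k) = (\<integral>\<^sup>+p. f (prod.swap p) \<partial>joint_meas \<mu> l k)"
proof -
  have [measurable_cong]: "sets (joint_meas \<mu> l k) = sets (\<mu> \<Otimes>\<^sub>M \<mu>)" by simp
  have [measurable]: "prod.swap \<in> \<mu> \<Otimes>\<^sub>M \<mu> \<rightarrow>\<^sub>M \<mu> \<Otimes>\<^sub>M \<mu>"
    by (simp add: prod.swap_def[abs_def])
  show ?thesis
    using f by (simp add: joint_meas_rev_eq_distr[OF k l ne] nn_integral_distr)
qed

text \<open>The integral formula in \<open>is_ratio\<close> is the value of the density on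
  \<open>U\<close>, so demanding it for all \<open>U\<close> is equality of measures. In this form
  the rules for densities apply: integrals, null sets and absolute continuity.\<close>

lemma is_ratio_iff_density:
  assumes k: "k \<in> \<mu> \<rightarrow>\<^sub>M prob_algebra \<mu>" and l: "l \<in> borel_measurable \<mu>"
    and ne: "space \<mu> \<noteq> {}"
  shows "is_ratio \<mu> l k r \<longleftrightarrow> (\<lambda>(x, y). r x y) \<in> borel_measurable (\<mu> \<Otimes>\<^sub>M \<mu>) \<and>
    joint_meas_rev \<mu> l k = density (joint_meas \<mu> l k) (\<lambda>(x, y). r x y)"
proof -
  have [measurable_cong]: "sets (joint_meas \<mu> l k) = sets (\<mu> \<Otimes>\<^sub>M \<mu>)" by simp
  have *: "emeasure (density (joint_meas \<mu> l k) (\<lambda>(x, y). r x y)) U =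
      (\<integral>\<^sup>+x. (\<integral>\<^sup>+y. indicator U (x, y) * r x y * ennreal (l x) \<partial>k x) \<partial>\<mu>)"
    if [measurable]: "(\<lambda>(x, y). r x y) \<in> borel_measurable (\<mu> \<Otimes>\<^sub>M \<mu>)" "U \<in> sets (\<mu> \<Otimes>\<^sub>M \<mu>)" for U
    by (simp add: emeasure_density nn_integral_joint_meas[OF k l ne] mult.commute)
  show ?thesis
    unfolding is_ratio_def by (auto simp: * intro!: measure_eqI)
qed

section \<open>The mixed kernel and its joint measure\<close>

text \<open>Sampling from the mixture means drawing an index with weights \<open>c x\<close> and
  then applying the chosen kernel. Integrals over the weighted counting measure are series, which
  yields the integral formula for the mixture.\<close>

lemma mixed_kernel_eq_bind:
  assumes k: "\<And>i. i \<ge> 1 \<Longrightarrow> k i \<in> \<mu> \<rightarrow>\<^sub>M prob_algebra \<mu>" and x: "x \<in> space \<mu>"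
  shows "mixed_kernel \<mu> c k x =
    density (count_space UNIV) (\<lambda>i. ennreal (c x (Suc i))) \<bind> (\<lambda>i. k (Suc i) x)"
proof -
  have ks: "k (Suc i) x \<in> space (subprob_algebra \<mu>)" for i
    using measurable_space[OF measurable_prob_algebraD[OF k] x] by simp
  have K: "(\<lambda>i. k (Suc i) x) \<in>
      density (count_space UNIV) (\<lambda>i. ennreal (c x (Suc i))) \<rightarrow>\<^sub>M subprob_algebra \<mu>"
    using ks by simp
  show ?thesis
  proof (rule measure_eqI)
    show "sets (mixed_kernel \<mu> c k x) =
        sets (density (count_space UNIV) (\<lambda>i. ennreal (c x (Suc i))) \<bind> (\<lambda>i. k (Suc i) x))"
      by (subst sets_bind[OF sets_kernel[OF K]]) auto
    fix U assume "U \<in> sets (mixed_kernel \<mu> c k x)"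
    then have U: "U \<in> sets \<mu>" by simp
    show "emeasure (mixed_kernel \<mu> c k x) U =
        emeasure (density (count_space UNIV) (\<lambda>i. ennreal (c x (Suc i))) \<bind> (\<lambda>i. k (Suc i) x)) U"
      by (simp add: emeasure_mixed_kernel[OF k x U] emeasure_bind[OF _ K U] nn_integral_density
          nn_integral_count_space_nat)
  qed
qed

lemma nn_integral_mixed_kernel:
  assumes k: "\<And>i. i \<ge> 1 \<Longrightarrow> k i \<in> \<mu> \<rightarrow>\<^sub>M prob_algebra \<mu>" and x: "x \<in> space \<mu>"
    and f: "f \<in> borel_measurable \<mu>"
  shows "(\<integral>\<^sup>+y. f y \<partial>mixed_kernel \<mu> c k x) =
    (\<Sum>i. ennreal (c x (Suc i)) * (\<integral>\<^sup>+y. f y \<partial>k (Suc i) x))"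
proof -
  have ks: "k (Suc i) x \<in> space (subprob_algebra \<mu>)" for i
    using measurable_space[OF measurable_prob_algebraD[OF k] x] by simp
  have K: "(\<lambda>i. k (Suc i) x) \<in>
      density (count_space UNIV) (\<lambda>i. ennreal (c x (Suc i))) \<rightarrow>\<^sub>M subprob_algebra \<mu>"
    using ks by simp
  show ?thesis
    by (simp add: mixed_kernel_eq_bind[OF k x] nn_integral_bind[OF f K] nn_integral_density
        nn_integral_count_space_nat)
qed

text \<open>The total mass is the sum of the weights, because every \<open>k (Suc i) x\<close> has
  mass 1. Evaluation at a fixed set is a countable sum of measurable functions.\<close>

lemma mixed_kernel_measurable:
  assumes k: "\<And>i. i \<ge> 1 \<Longrightarrow> k i \<in> \<mu> \<rightarrow>\<^sub>M prob_algebra \<mu>"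
    and c[measurable]: "\<And>i. i \<ge> 1 \<Longrightarrow> (\<lambda>x. c x i) \<in> borel_measurable \<mu>"
    and c0: "\<And>x i. x \<in> space \<mu> \<Longrightarrow> i \<ge> 1 \<Longrightarrow> 0 \<le> c x i"
    and c1: "\<And>x. x \<in> space \<mu> \<Longrightarrow> (\<lambda>i. c x (Suc i)) sums 1"
  shows "mixed_kernel \<mu> c k \<in> \<mu> \<rightarrow>\<^sub>M prob_algebra \<mu>"
proof -
  have P: "prob_space (mixed_kernel \<mu> c k x)" if x: "x \<in> space \<mu>" for x
  proof
    have "emeasure (k (Suc i) x) (space \<mu>) = 1" for i
    proof -
      have "sets (k (Suc i) x) = sets \<mu>" "prob_space (k (Suc i) x)"
        using measurable_space[OF k x, of "Suc i"] by (simp_all add: space_prob_algebra)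
      then show ?thesis
        using prob_space.emeasure_space_1 sets_eq_imp_space_eq by metis
    qed
    moreover have "(\<Sum>i. ennreal (c x (Suc i))) = 1"
      by (subst suminf_ennreal_eq[OF c0[OF x] c1[OF x]]) simp_all
    ultimately show "emeasure (mixed_kernel \<mu> c k x) (space (mixed_kernel \<mu> c k x)) = 1"
      using sets_eq_imp_space_eq[OF sets_mixed_kernel[of \<mu> c k x]]
      by (simp add: emeasure_mixed_kernel[OF k x])
  qed
  show ?thesis
  proof (rule measurable_prob_algebraI)
    show "mixed_kernel \<mu> c k \<in> \<mu> \<rightarrow>\<^sub>M subprob_algebra \<mu>"
    proof (rule measurable_subprob_algebra)
      fix A assume A[measurable]: "A \<in> sets \<mu>"
      have [measurable]: "(\<lambda>x. emeasure (k (Suc i) x) A) \<in> borel_measurable \<mu>" for i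
        by (rule measurable_emeasure_kernel[OF measurable_prob_algebraD[OF k] A]) simp
      have "(\<lambda>x. \<Sum>i. ennreal (c x (Suc i)) * emeasure (k (Suc i) x) A) \<in> borel_measurable \<mu>"
        by measurable
      then show "(\<lambda>x. emeasure (mixed_kernel \<mu> c k x) A) \<in> borel_measurable \<mu>"
        by (simp add: emeasure_mixed_kernel[OF k _ A] cong: measurable_cong)
    qed (use P in \<open>auto intro: prob_space_imp_subprob_space\<close>)
  qed (use P in auto)
qed

text \<open>The series is exchanged with the integral over \<open>\<mu>\<close>. The weight is
  constant in the second coordinate, hence it can be absorbed into the integrand as a function of
  \<open>fst p\<close>.\<close>

lemma nn_integral_joint_meas_mixed_kernel:
  assumes k: "\<And>i. i \<ge> 1 \<Longrightarrow> k i \<in> \<mu> \<rightarrow>\<^sub>M prob_algebra \<mu>"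
    and mixed: "mixed_kernel \<mu> c k \<in> \<mu> \<rightarrow>\<^sub>M prob_algebra \<mu>"
    and c[measurable]: "\<And>i. i \<ge> 1 \<Longrightarrow> (\<lambda>x. c x i) \<in> borel_measurable \<mu>"
    and l[measurable]: "l \<in> borel_measurable \<mu>" and ne: "space \<mu> \<noteq> {}"
    and f[measurable]: "f \<in> borel_measurable (\<mu> \<Otimes>\<^sub>M \<mu>)"
  shows "(\<integral>\<^sup>+p. f p \<partial>joint_meas \<mu> l (mixed_kernel \<mu> c k)) =
    (\<Sum>i. \<integral>\<^sup>+p. ennreal (c (fst p) (Suc i)) * f p \<partial>joint_meas \<mu> l (k (Suc i)))"
proof -
  have ks[measurable]: "k (Suc i) \<in> \<mu> \<rightarrow>\<^sub>M subprob_algebra \<mu>" for i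
    using measurable_prob_algebraD[OF k] by simp
  have "(\<integral>\<^sup>+p. f p \<partial>joint_meas \<mu> l (mixed_kernel \<mu> c k)) =
      (\<integral>\<^sup>+x. (\<Sum>i. \<integral>\<^sup>+y. ennreal (c x (Suc i)) * f (x, y) * ennreal (l x) \<partial>k (Suc i) x) \<partial>\<mu>)"
    unfolding nn_integral_joint_meas[OF mixed l ne f]
  proof (rule nn_integral_cong)
    fix x assume x[measurable]: "x \<in> space \<mu>"
    have [measurable_cong, simp]: "sets (k (Suc i) x) = sets \<mu>" for i
      using sets_kernel[OF ks x] .
    have [measurable]: "(\<lambda>y. f (x, y)) \<in> borel_measurable \<mu>"
      by measurable
    have "(\<lambda>y. f (x, y) * ennreal (l x)) \<in> borel_measurable \<mu>"
      by measurable
    then have "(\<lambda>y. f (x, y) * ennreal (l x)) \<in> borel_measurable (k (Suc i) x)" for i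
      by (simp cong: measurable_cong_sets)
    then show "(\<integral>\<^sup>+y. f (x, y) * ennreal (l x) \<partial>mixed_kernel \<mu> c k x) =
        (\<Sum>i. \<integral>\<^sup>+y. ennreal (c x (Suc i)) * f (x, y) * ennreal (l x) \<partial>k (Suc i) x)"
      by (simp add: nn_integral_mixed_kernel[OF k x] mult.assoc nn_integral_cmult)
  qed
  also have "\<dots> =
      (\<Sum>i. \<integral>\<^sup>+x. (\<integral>\<^sup>+y. ennreal (c x (Suc i)) * f (x, y) * ennreal (l x) \<partial>k (Suc i) x) \<partial>\<mu>)"
    by (intro nn_integral_suminf nn_integral_measurable_subprob_algebra2[OF _ ks]) measurable
  also have "\<dots> = (\<Sum>i. \<integral>\<^sup>+p. ennreal (c (fst p) (Suc i)) * f p \<partial>joint_meas \<mu> l (k (Suc i)))"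
    using k by (simp add: nn_integral_joint_meas[OF _ l ne])
  finally show ?thesis .
qed

section \<open>Detection of the kernel almost everywhere\<close>

text \<open>Both laws are evaluated on the event that the third coordinate differs from
  \<open>i\<close>. The law with constant third coordinate gives it mass 0, so \<open>e\<close>
  differs from \<open>i\<close> only on a null set; weighting by \<open>l\<close> preserves null
  sets.\<close>

lemma AE_joint_meas_detect:
  assumes k: "k \<in> \<mu> \<rightarrow>\<^sub>M prob_algebra \<mu>" and l[measurable]: "l \<in> borel_measurable \<mu>"
    and ne: "space \<mu> \<noteq> {}" and i: "i \<in> I" and [simp]: "countable I"
    and e[measurable]: "(\<lambda>(x, y). e x y) \<in> \<mu> \<Otimes>\<^sub>M \<mu> \<rightarrow>\<^sub>M count_space I"
    and eq: "\<mu> \<bind> (\<lambda>x. k x \<bind> (\<lambda>y. return (\<mu> \<Otimes>\<^sub>M \<mu> \<Otimes>\<^sub>M count_space I) (x, y, e x y))) =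
      \<mu> \<bind> (\<lambda>x. k x \<bind> (\<lambda>y. return (\<mu> \<Otimes>\<^sub>M \<mu> \<Otimes>\<^sub>M count_space I) (x, y, i)))"
  shows "AE (x, y) in joint_meas \<mu> l k. e x y = i"
proof -
  note ks[measurable] = measurable_prob_algebraD[OF k]
  have [measurable]: "(\<lambda>p. e (fst p) (snd p)) \<in> \<mu> \<Otimes>\<^sub>M \<mu> \<rightarrow>\<^sub>M count_space I"
    using e by (simp add: case_prod_beta')
  define B where "B = {p \<in> space (\<mu> \<Otimes>\<^sub>M \<mu> \<Otimes>\<^sub>M count_space I). snd (snd p) \<noteq> i}"
  have B[measurable]: "B \<in> sets (\<mu> \<Otimes>\<^sub>M \<mu> \<Otimes>\<^sub>M count_space I)"
    unfolding B_def by measurable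
  \<comment> \<open>Stated for a general labelling \<open>g\<close> so that one computation serves
    both laws: \<open>g = e\<close> and the constant \<open>i\<close>.\<close>
  have law: "emeasure (\<mu> \<bind> (\<lambda>x. k x \<bind> (\<lambda>y. return (\<mu> \<Otimes>\<^sub>M \<mu> \<Otimes>\<^sub>M count_space I) (x, y, g x y)))) B
      = (\<integral>\<^sup>+x. \<integral>\<^sup>+y. indicator {p. g (fst p) (snd p) \<noteq> i} (x, y) \<partial>k x \<partial>\<mu>)"
    if [measurable]: "(\<lambda>(x, y). g x y) \<in> \<mu> \<Otimes>\<^sub>M \<mu> \<rightarrow>\<^sub>M count_space I" for g
  proof -
    let ?N = "\<mu> \<Otimes>\<^sub>M \<mu> \<Otimes>\<^sub>M count_space I"
    have [measurable]: "(\<lambda>p. g (fst p) (snd p)) \<in> \<mu> \<Otimes>\<^sub>M \<mu> \<rightarrow>\<^sub>M count_space I"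
      using that by (simp add: case_prod_beta')
    have R: "(\<lambda>(x, y). return ?N (x, y, g x y)) \<in> \<mu> \<Otimes>\<^sub>M \<mu> \<rightarrow>\<^sub>M subprob_algebra ?N"
      unfolding case_prod_beta'
      by (rule measurable_compose[OF _ return_measurable]) measurable
    have K: "(\<lambda>x. k x \<bind> (\<lambda>y. return ?N (x, y, g x y))) \<in> \<mu> \<rightarrow>\<^sub>M subprob_algebra ?N"
      by (rule measurable_bind'[OF ks]) (use R in \<open>simp add: case_prod_beta'\<close>)
    show ?thesis
      unfolding emeasure_bind[OF ne K B]
    proof (rule nn_integral_cong)
      fix x assume x[measurable]: "x \<in> space \<mu>"
      have sk[measurable_cong, simp]: "sets (k x) = sets \<mu>"
        using sets_kernel[OF ks x] .
      have sp[simp]: "space (k x) = space \<mu>"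
        using sets_eq_imp_space_eq[OF sk] .
      have [measurable]: "Pair x \<in> k x \<rightarrow>\<^sub>M \<mu> \<Otimes>\<^sub>M \<mu>"
        using measurable_Pair1'[OF x, of \<mu>] by (simp cong: measurable_cong_sets)
      have Rx: "(\<lambda>y. return ?N (x, y, g x y)) \<in> k x \<rightarrow>\<^sub>M subprob_algebra ?N"
        using measurable_compose[OF \<open>Pair x \<in> _\<close> R] by (simp only: case_prod_conv)
      have gx: "g x y \<in> I" if "y \<in> space \<mu>" for y
        using measurable_space[of "\<lambda>(x, y). g x y" "\<mu> \<Otimes>\<^sub>M \<mu>" "count_space I" "(x, y)"] x that
        by (simp add: space_pair_measure)
      have "emeasure (k x \<bind> (\<lambda>y. return ?N (x, y, g x y))) B =
          (\<integral>\<^sup>+y. emeasure (return ?N (x, y, g x y)) B \<partial>k x)"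
        by (rule emeasure_bind[OF _ Rx B]) (simp add: ne)
      also have "\<dots> = (\<integral>\<^sup>+y. indicator {p. g (fst p) (snd p) \<noteq> i} (x, y) \<partial>k x)"
        using x gx
        by (intro nn_integral_cong) (simp add: B_def[symmetric] emeasure_return[OF B],
            simp add: B_def space_pair_measure indicator_def)
      finally show "emeasure (k x \<bind> (\<lambda>y. return ?N (x, y, g x y))) B =
          (\<integral>\<^sup>+y. indicator {p. g (fst p) (snd p) \<noteq> i} (x, y) \<partial>k x)" .
    qed
  qed
  \<comment> \<open>The event of a wrong label, cut down to the product space to make it a
    measurable set.\<close>
  let ?D = "{p \<in> space (\<mu> \<Otimes>\<^sub>M \<mu>). e (fst p) (snd p) \<noteq> i}"
  have D[measurable]: "?D \<in> sets (\<mu> \<Otimes>\<^sub>M \<mu>)" by measurable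
  have sets_k: "sets (k x) = sets \<mu>" if "x \<in> space \<mu>" for x
    using sets_kernel[OF ks that] .
  have "(\<integral>\<^sup>+x. \<integral>\<^sup>+y. indicator ?D (x, y) \<partial>k x \<partial>\<mu>) =
      (\<integral>\<^sup>+x. \<integral>\<^sup>+y. indicator {p. e (fst p) (snd p) \<noteq> i} (x, y) \<partial>k x \<partial>\<mu>)"
    by (intro nn_integral_cong)
       (auto simp: indicator_def space_pair_measure dest: sets_eq_imp_space_eq[OF sets_k])
  \<comment> \<open>For the constant label \<open>i\<close> the indicator in \<open>law\<close> is
    that of the empty set, and \<open>eq\<close> carries the value 0 over to
    \<open>e\<close>.\<close>
  also have "\<dots> = 0"
    using law[of e] law[of "\<lambda>_ _. i"] i by (simp add: eq)
  finally have "(\<integral>\<^sup>+x. \<integral>\<^sup>+y. indicator ?D (x, y) \<partial>k x \<partial>\<mu>) = 0" .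
  then have "AE x in \<mu>. (\<integral>\<^sup>+y. indicator ?D (x, y) \<partial>k x) = 0"
    by (subst (asm) nn_integral_0_iff_AE)
       (auto intro!: nn_integral_measurable_subprob_algebra2[OF _ ks])
  then have "AE x in \<mu>. (\<integral>\<^sup>+y. indicator ?D (x, y) * ennreal (l x) \<partial>k x) = 0"
  proof (rule AE_mp, intro AE_I2 impI)
    fix x assume x[measurable]: "x \<in> space \<mu>"
    have [simp]: "sets (k x) = sets \<mu>"
      using sets_kernel[OF ks x] .
    have "Pair x \<in> k x \<rightarrow>\<^sub>M \<mu> \<Otimes>\<^sub>M \<mu>"
      using measurable_Pair1'[OF x, of \<mu>] by (simp cong: measurable_cong_sets)
    from measurable_compose[OF this borel_measurable_indicator[OF D]]
    have "(\<integral>\<^sup>+y. indicator ?D (x, y) * ennreal (l x) \<partial>k x) =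
        (\<integral>\<^sup>+y. indicator ?D (x, y) \<partial>k x) * ennreal (l x)"
      by (rule nn_integral_multc)
    moreover assume "(\<integral>\<^sup>+y. indicator ?D (x, y) \<partial>k x) = 0"
    ultimately show "(\<integral>\<^sup>+y. indicator ?D (x, y) * ennreal (l x) \<partial>k x) = 0"
      by (simp only: mult_zero_left)
  qed
  then have "emeasure (joint_meas \<mu> l k) ?D = 0"
    unfolding emeasure_joint_meas[OF k l D] by (simp cong: nn_integral_cong_AE)
  then show ?thesis
    by (intro AE_I[of _ _ ?D]) (auto simp: sets_eq_imp_space_eq[OF sets_joint_meas])
qed

section \<open>Ratio and Green property of the mixture\<close>

theorem theorem7p1:
  fixes \<mu> :: "'a measure"
    and l :: "'a \<Rightarrow> real"
    and k :: "nat \<Rightarrow> 'a \<Rightarrow> 'a measure"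
    and r :: "nat \<Rightarrow> 'a \<Rightarrow> 'a \<Rightarrow> ennreal"
    and c :: "'a \<Rightarrow> nat \<Rightarrow> real"
    and e :: "'a \<Rightarrow> 'a \<Rightarrow> nat"
  assumes "standard_borel \<mu>" and "prob_space \<mu>"
    and "l \<in> borel_measurable \<mu>" and "\<And>\<omega>. \<omega> \<in> space \<mu> \<Longrightarrow> 0 \<le> l \<omega>"
    and "\<And>i. i \<ge> 1 \<Longrightarrow> green_kernel \<mu> l (k i)"
    and "\<And>i. i \<ge> 1 \<Longrightarrow> is_ratio \<mu> l (k i) (r i)"
    and "(\<lambda>(\<omega>, i). c \<omega> i) \<in> borel_measurable (\<mu> \<Otimes>\<^sub>M count_space {1..})"
    and "\<And>\<omega> i. \<omega> \<in> space \<mu> \<Longrightarrow> i \<ge> 1 \<Longrightarrow> c \<omega> i \<in> {0..1}"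
    and "\<And>\<omega>. \<omega> \<in> space \<mu> \<Longrightarrow> (\<lambda>i. c \<omega> (Suc i)) sums 1"
    and "(\<lambda>(\<omega>, \<omega>'). e \<omega> \<omega>') \<in> \<mu> \<Otimes>\<^sub>M \<mu> \<rightarrow>\<^sub>M count_space {1..}"
    and detect: "\<And>i. i \<ge> 1 \<Longrightarrow>
      \<mu> \<bind> (\<lambda>\<omega>. k i \<omega> \<bind> (\<lambda>\<omega>'.
        return (\<mu> \<Otimes>\<^sub>M \<mu> \<Otimes>\<^sub>M count_space {1..}) (\<omega>, \<omega>', e \<omega> \<omega>'))) =
      \<mu> \<bind> (\<lambda>\<omega>. k i \<omega> \<bind> (\<lambda>\<omega>'.
        return (\<mu> \<Otimes>\<^sub>M \<mu> \<Otimes>\<^sub>M count_space {1..}) (\<omega>, \<omega>', i)))"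
    (* Implicit in the quotient c \<omega>' i / c \<omega> i: if k i can be selected at \<omega> and moves
       to \<omega>', then it can also be selected at \<omega>'. Otherwise the mixture need not be Green. *)
    and supp: "\<And>i. i \<ge> 1 \<Longrightarrow>
      AE (\<omega>, \<omega>') in joint_meas \<mu> l (k i). c \<omega> i > 0 \<longrightarrow> c \<omega>' i > 0"
  shows "green_kernel \<mu> l (mixed_kernel \<mu> c k) \<and>
    is_ratio \<mu> l (mixed_kernel \<mu> c k)
      (\<lambda>\<omega> \<omega>'. let i = e \<omega> \<omega>' in r i \<omega> \<omega>' * (ennreal (c \<omega>' i) / ennreal (c \<omega> i)))"
proof -
  interpret prob_space \<mu> by fact
  \<comment> \<open>Over an empty space bind takes a degenerate default value, so the integral
    formulas ask for a nonempty space; a probability space is one.\<close>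
  note ne = not_empty
  note l[measurable] = \<open>l \<in> borel_measurable \<mu>\<close>
  have k: "k i \<in> \<mu> \<rightarrow>\<^sub>M prob_algebra \<mu>" if "i \<ge> 1" for i
    using assms(5)[OF that] by (simp add: green_kernel_def)
  have c[measurable]: "(\<lambda>x. c x i) \<in> borel_measurable \<mu>" if "i \<ge> 1" for i
    using measurable_compose[OF _ assms(7), of "\<lambda>x. (x, i)" \<mu>] that by simp
  have c0: "0 \<le> c x i" if "x \<in> space \<mu>" "i \<ge> 1" for x i
    using assms(8)[OF that] by simp
  have rm[measurable]: "(\<lambda>(x, y). r i x y) \<in> borel_measurable (\<mu> \<Otimes>\<^sub>M \<mu>)"
    and rev: "joint_meas_rev \<mu> l (k i) = density (joint_meas \<mu> l (k i)) (\<lambda>(x, y). r i x y)"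
    if "i \<ge> 1" for i
    using assms(6)[OF that] is_ratio_iff_density[OF k[OF that] l ne] by auto
  let ?K = "mixed_kernel \<mu> c k"
  have K: "?K \<in> \<mu> \<rightarrow>\<^sub>M prob_algebra \<mu>"
    using k c c0 assms(9) by (rule mixed_kernel_measurable)
  \<comment> \<open>The candidate ratio with the index frozen. \<open>R\<close> selects among these
    countably many functions by the measurable label \<open>e\<close>, which makes it
    measurable.\<close>
  define q where "q = (\<lambda>i (x, y). r i x y * (ennreal (c y i) / ennreal (c x i)))"
  define R where "R = (\<lambda>x y. let i = e x y in r i x y * (ennreal (c y i) / ennreal (c x i)))"
  have R: "(\<lambda>(x, y). R x y) = (\<lambda>p. q ((\<lambda>(x, y). e x y) p) p)"
    by (auto simp: R_def q_def Let_def)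
  have qm[measurable]: "q i \<in> borel_measurable (\<mu> \<Otimes>\<^sub>M \<mu>)" if "i \<ge> 1" for i
    using rm[OF that] c[OF that] unfolding q_def by measurable
  have Rm[measurable]: "(\<lambda>(x, y). R x y) \<in> borel_measurable (\<mu> \<Otimes>\<^sub>M \<mu>)"
    unfolding R by (rule measurable_compose_countable'[OF qm assms(10)]) simp_all
  have [measurable_cong]: "sets (joint_meas \<mu> l j) = sets (\<mu> \<Otimes>\<^sub>M \<mu>)" for j by simp
  have swap[measurable]: "prod.swap \<in> \<mu> \<Otimes>\<^sub>M \<mu> \<rightarrow>\<^sub>M \<mu> \<Otimes>\<^sub>M \<mu>"
    by (simp add: prod.swap_def[abs_def])
  have balance: "AE p in joint_meas \<mu> l (k i). (case p of (x, y) \<Rightarrow> r i x y * ennreal (c y i)) =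
      ennreal (c (fst p) i) * (case p of (x, y) \<Rightarrow> R x y)" if i: "i \<ge> 1" for i
  proof -
    note [measurable] = c[OF i] rm[OF i]
    \<comment> \<open>The support condition read in the reversed direction: the swap exchanges the
      roles of the two coordinates.\<close>
    have "AE p in joint_meas_rev \<mu> l (k i). c (snd p) i > 0 \<longrightarrow> c (fst p) i > 0"
      unfolding joint_meas_rev_eq_distr[OF k[OF i] l ne]
      using supp[OF i] by (subst AE_distr_iff) (auto simp: case_prod_beta')
    \<comment> \<open>Null sets of a density are null for the base measure only where the density is
      positive, whence the premise on \<open>r i\<close>.\<close>
    then have s: "AE p in joint_meas \<mu> l (k i).
        0 < (case p of (x, y) \<Rightarrow> r i x y) \<longrightarrow> c (snd p) i > 0 \<longrightarrow> c (fst p) i > 0"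
      unfolding rev[OF i] by (subst (asm) AE_density) auto
    have d: "AE (x, y) in joint_meas \<mu> l (k i). e x y = i"
      using detect[OF i] i assms(10) by (intro AE_joint_meas_detect[OF k[OF i] l ne]) auto
    from s d show ?thesis
    proof eventually_elim
      case (elim p)
      obtain x y where p: "p = (x, y)" by (cases p)
      show ?case
      proof (cases "c x i > 0")
        \<comment> \<open>The weight is positive and finite, so it cancels; the detected index
          identifies \<open>R\<close> with the formula for \<open>i\<close>.\<close>
        case True
        then have "ennreal (c x i) * (ennreal (c y i) / ennreal (c x i)) = ennreal (c y i)"
          by (simp add: ennreal_times_divide mult_divide_eq_ennreal
              mult.commute[of "ennreal (c x i)"])
        with elim show ?thesis
          by (simp add: p R_def mult.left_commute[of "ennreal (c x i)"])
      next
        \<comment> \<open>The right side vanishes, since 0 times anything is 0 in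
          \<open>ennreal\<close>, even if the quotient is infinite. On the left, \<open>s\<close>
          forces \<open>r i x y\<close> or the weight at \<open>y\<close> to vanish.\<close>
        case False
        with elim show ?thesis
          by (auto simp: p not_less ennreal_neg zero_less_iff_neq_zero)
      qed
    qed
  qed
  have dens: "joint_meas_rev \<mu> l ?K = density (joint_meas \<mu> l ?K) (\<lambda>(x, y). R x y)"
  proof (rule measure_eqI)
    fix U assume "U \<in> sets (joint_meas_rev \<mu> l ?K)"
    then have U[measurable]: "U \<in> sets (\<mu> \<Otimes>\<^sub>M \<mu>)" by simp
    have "emeasure (joint_meas_rev \<mu> l ?K) U = (\<integral>\<^sup>+p. indicator U p \<partial>joint_meas_rev \<mu> l ?K)"
      by simp
    also have "\<dots> = (\<integral>\<^sup>+p. indicator U (prod.swap p) \<partial>joint_meas \<mu> l ?K)"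
      by (rule nn_integral_joint_meas_rev[OF K l ne]) measurable
    also have "\<dots> = (\<Sum>i. \<integral>\<^sup>+p. ennreal (c (fst p) (Suc i)) * indicator U (prod.swap p)
        \<partial>joint_meas \<mu> l (k (Suc i)))"
      by (rule nn_integral_joint_meas_mixed_kernel[OF k K c l ne]) measurable
    also have "\<dots> = (\<Sum>i. \<integral>\<^sup>+p. ennreal (c (fst p) (Suc i)) * ((case p of (x, y) \<Rightarrow> R x y) *
        indicator U p) \<partial>joint_meas \<mu> l (k (Suc i)))"
    \<comment> \<open>Each summand is treated separately: swapping moves the weight to the second
      coordinate, the ratio of \<open>k i\<close> returns to \<open>joint_meas\<close>, and
      \<open>balance\<close> restores the weight at the first coordinate together with
      \<open>R\<close>.\<close>
    proof (intro suminf_cong)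
      fix n
      define i where "i = Suc n"
      have i: "i \<ge> 1" by (simp add: i_def)
      note [measurable] = c[OF i] rm[OF i]
      have "(\<integral>\<^sup>+p. ennreal (c (fst p) i) * indicator U (prod.swap p) \<partial>joint_meas \<mu> l (k i)) =
          (\<integral>\<^sup>+p. ennreal (c (snd p) i) * indicator U p \<partial>joint_meas_rev \<mu> l (k i))"
        by (subst nn_integral_joint_meas_rev[OF k[OF i] l ne]) simp_all
      also have "\<dots> = (\<integral>\<^sup>+p. (case p of (x, y) \<Rightarrow> r i x y) *
          (ennreal (c (snd p) i) * indicator U p) \<partial>joint_meas \<mu> l (k i))"
        unfolding rev[OF i] by (rule nn_integral_density) measurable
      also have "\<dots> = (\<integral>\<^sup>+p. ennreal (c (fst p) i) * ((case p of (x, y) \<Rightarrow> R x y) *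
          indicator U p) \<partial>joint_meas \<mu> l (k i))"
        using balance[OF i]
        by (intro nn_integral_cong_AE) (auto simp: case_prod_beta' simp flip: mult.assoc)
      finally show "(\<integral>\<^sup>+p. ennreal (c (fst p) (Suc n)) * indicator U (prod.swap p)
          \<partial>joint_meas \<mu> l (k (Suc n))) = (\<integral>\<^sup>+p. ennreal (c (fst p) (Suc n)) *
          ((case p of (x, y) \<Rightarrow> R x y) * indicator U p) \<partial>joint_meas \<mu> l (k (Suc n)))"
        unfolding i_def .
    qed
    \<comment> \<open>The decomposition of the mixture, used backwards, reassembles the
      summands.\<close>
    also have "\<dots> = (\<integral>\<^sup>+p. (case p of (x, y) \<Rightarrow> R x y) * indicator U p \<partial>joint_meas \<mu> l ?K)"
      by (rule nn_integral_joint_meas_mixed_kernel[OF k K c l ne, symmetric]) measurable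
    also have "\<dots> = emeasure (density (joint_meas \<mu> l ?K) (\<lambda>(x, y). R x y)) U"
      by (simp add: emeasure_density)
    finally show "emeasure (joint_meas_rev \<mu> l ?K) U =
        emeasure (density (joint_meas \<mu> l ?K) (\<lambda>(x, y). R x y)) U" .
  qed simp
  have "is_ratio \<mu> l ?K R"
    using Rm dens is_ratio_iff_density[OF K l ne] by auto
  \<comment> \<open>Absolute continuity comes for free once the reversed measure is a
    density.\<close>
  moreover have "green_kernel \<mu> l ?K"
    unfolding green_kernel_def dens using K
    by (auto intro!: absolutely_continuousI_density)
  ultimately show ?thesis
    unfolding R_def by simp
qed

end
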